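(* Let $n \ge 1$, let $1 \le p < q < \infty$, and let $t > 0$ satisfy $$\frac{2}{e^t+1} > 1 - \Bigl(\frac1p - \frac1q\Bigr), \qquad\text{or equivalently}\qquad t < \log\Biggl(\frac{1+(\frac1p-\frac1q)}{1-(\frac1p-\frac1q)}\Biggr).$$ Then the $L^p(\gamma)$--$L^q(\gamma)$ off-diagonal estimates for $e^{tL}$ do not hold for the class of testing sets $$\{(E,F) : E = B = B(c_B,|c_B|^{-1}),\ F = C_k(B),\ 2^k \le |c_B|\}.$$ That is, there do not exist constants $c > 0$, $\theta \ge 0$ and $K > 0$ such that for every $c_B \in \mathbb{R}^n$ and every $k \in \mathbb{N}$ with $2^k \le |c_B|$, setting $B = B(c_B,|c_B|^{-1})$, $E = B$ and $F = C_k(B)$, the inequality $$\biggl(\int_F |e^{tL}(\mathbf{1}_E f)|^q\,d\gamma\biggr)^{1/q} \le K\, t^{-\theta} \exp\Bigl(-c\,\frac{\operatorname{dist}(E,F)^2}{t}\Bigr)\biggl(\int_E |f|^p\,d\gamma\biggr)^{1/p}$$ holds for all $f \in L^p(\gamma)$.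
   Context: $\gamma$ is the Gaussian probability measure $d\gamma(x) = \pi^{-n/2} e^{-|x|^2}\,dx$ on $\mathbb{R}^n$, and $L^p(\gamma) = L^p(\mathbb{R}^n,\gamma)$. The Ornstein--Uhlenbeck operator is $L = \frac12\Delta - \langle x,\nabla\rangle = -\frac12\nabla^*\nabla$, with $\nabla^*$ the adjoint of $\nabla$ in $L^2(\gamma)$; it generates the Ornstein--Uhlenbeck semigroup $(e^{tL})_{t>0}$, given by $$e^{tL}u(x) = \int_{\mathbb{R}^n} M_t(x,y)u(y)\,d\gamma(y),\qquad M_t(x,y) = \frac{1}{(1-e^{-2t})^{n/2}} \exp\Bigl(-e^{-2t}\frac{|x-y|^2}{1-e^{-2t}}\Bigr)\exp\Bigl(2e^{-t}\frac{\langle x,y\rangle}{1+e^{-t}}\Bigr).$$ The same formula defines $e^{tL}u$ for $u \in L^p(\gamma)$. $B(c,r) = \{x\in\mathbb{R}^n : |x-c|<r\}$; for a ball $B = B(c_B,r_B)$ and $\lambda>0$, $\lambda B := B(c_B,\lambda r_B)$. The annuli are $C_0(B) := 2B$ and $C_k(B) := 2^{k+1}B\setminus 2^kB$ for $k\ge1$; here $\mathbb{N}$ includes $0$. $\operatorname{dist}(E,F) := \inf\{|x-y| : x\in E, y\in F\}$. *)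

theory Defs
  imports "HOL-Analysis.Analysis"
begin

definition gauss :: "(real ^ 'n) measure" where
  "gauss = density lborel
     (\<lambda>x. ennreal (pi powr (- real CARD('n) / 2) * exp (- (norm x)\<^sup>2)))"

text \<open>Elements of \<open>L\<^sup>p\<close> are represented by functions, not by classes modulo null sets.\<close>

definition Lp_space :: "'a measure \<Rightarrow> real \<Rightarrow> ('a \<Rightarrow> real) set" where
  "Lp_space M p = {f \<in> borel_measurable M. integrable M (\<lambda>x. \<bar>f x\<bar> powr p)}"

text \<open>Real powers of extended nonnegative numbers, for exponents \<open>a > 0\<close>.\<close>

definition ennreal_powr :: "ennreal \<Rightarrow> real \<Rightarrow> ennreal" where
  "ennreal_powr x a = (if x = \<infinity> then \<infinity> else ennreal (enn2real x powr a))"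

text \<open>The norm is extended-real valued, so that a divergent integral has norm \<open>\<infinity>\<close> rather than
  the value \<open>0\<close> which the Bochner integral assigns to it.\<close>

definition Lp_norm_on :: "'a measure \<Rightarrow> real \<Rightarrow> 'a set \<Rightarrow> ('a \<Rightarrow> real) \<Rightarrow> ennreal" where
  "Lp_norm_on M p A f =
     ennreal_powr (\<integral>\<^sup>+ x. ennreal (\<bar>f x\<bar> powr p) * indicator A x \<partial>M) (1 / p)"

definition mehler_kernel :: "real \<Rightarrow> real ^ 'n \<Rightarrow> real ^ 'n \<Rightarrow> real" where
  "mehler_kernel t x y =
     1 / (1 - exp (- 2 * t)) powr (real CARD('n) / 2)
     * exp (- exp (- 2 * t) * ((norm (x - y))\<^sup>2 / (1 - exp (- 2 * t))))
     * exp (2 * exp (- t) * ((x \<bullet> y) / (1 + exp (- t))))"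

text \<open>The Ornstein--Uhlenbeck semigroup \<open>e\<^bsup>tL\<^esup>\<close>, given by its Mehler kernel with respect to
  the Gaussian measure.\<close>

definition ou_semigroup :: "real \<Rightarrow> (real ^ 'n \<Rightarrow> real) \<Rightarrow> real ^ 'n \<Rightarrow> real" where
  "ou_semigroup t u x = (LINT y|gauss. mehler_kernel t x y * u y)"

text \<open>The annulus \<open>C\<^sub>k(B)\<close> of the ball \<open>B = B(c, r)\<close>.\<close>

definition annulus :: "real ^ 'n \<Rightarrow> real \<Rightarrow> nat \<Rightarrow> (real ^ 'n) set" where
  "annulus c r k =
     (if k = 0 then ball c (2 * r) else ball c (2 ^ (k + 1) * r) - ball c (2 ^ k * r))"

text \<open>The \<open>L\<^sup>p(\<gamma>)\<close>--\<open>L\<^sup>q(\<gamma>)\<close> off-diagonal estimates for \<open>e\<^bsup>tL\<^esup>\<close>, at a fixed time \<open>t\<close>,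
  for a class of testing sets; the constants \<open>K\<close>, \<open>\<theta>\<close>, \<open>c\<close> may depend on \<open>t\<close>, but not on the
  testing sets or on \<open>f\<close>.\<close>

definition off_diagonal_estimates ::
  "real \<Rightarrow> real \<Rightarrow> real \<Rightarrow> ((real ^ 'n) set \<times> (real ^ 'n) set) set \<Rightarrow> bool" where
  "off_diagonal_estimates p q t \<T> \<longleftrightarrow>
     (\<exists>c > 0. \<exists>\<theta> \<ge> 0. \<exists>K > 0. \<forall>(E, F) \<in> \<T>. \<forall>f \<in> Lp_space gauss p.
        Lp_norm_on gauss q F (ou_semigroup t (\<lambda>y. indicator E y * f y))
        \<le> ennreal (K * t powr (- \<theta>) * exp (- c * ((setdist E F)\<^sup>2 / t)))
           * Lp_norm_on gauss p E f)"

end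

theory Submission
  imports Defs "HOL-Real_Asymp.Real_Asymp"
begin

text \<open>Testing with \<open>k = 0\<close> and \<open>f = 1\<^sub>B\<close> suffices. On \<open>B = B(c, |c|\<^sup>-\<^sup>1)\<close> the quantities
  \<open>|x|\<^sup>2\<close> and \<open>\<langle>x, y\<rangle>\<close> differ from \<open>|c|\<^sup>2\<close> by at most a constant, so that \<open>e\<^bsup>tL\<^esup>1\<^sub>B\<close> is at least a
  multiple of \<open>exp (a |c|\<^sup>2) \<gamma>(B)\<close> on \<open>B \<subseteq> C\<^sub>0(B)\<close>, with \<open>a = 2 / (e\<^sup>t + 1)\<close>. The estimate would
  therefore bound \<open>exp (a |c|\<^sup>2) \<gamma>(B)\<^bsup>s\<^esup>\<close>, where \<open>s = 1 - (1/p - 1/q)\<close>. But \<open>\<gamma>(B)\<close> is at least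
  a multiple of \<open>|c|\<^sup>-\<^sup>n exp (-|c|\<^sup>2)\<close>, so that quantity is unbounded as \<open>|c| \<rightarrow> \<infinity>\<close> when \<open>a > s\<close>.\<close>

section \<open>Comparison of Gaussian and Lebesgue measure\<close>

lemma sets_gauss [simp, measurable_cong]: "sets gauss = sets borel"
  by (simp add: gauss_def)

text \<open>The density decreases in \<open>norm x\<close>, so on \<open>A\<close> it lies between
  its value at squared radius \<open>\<rho>\<close> and its value at the origin.\<close>

lemma emeasure_gauss_bounds:
  fixes A :: "(real ^ 'n) set"
  assumes "A \<in> sets borel" and "\<And>x. x \<in> A \<Longrightarrow> (norm x)\<^sup>2 \<le> \<rho>"
  shows "ennreal (pi powr (- real CARD('n) / 2) * exp (- \<rho>)) * emeasure lborel A \<le> emeasure gauss A"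
    and "emeasure gauss A \<le> ennreal (pi powr (- real CARD('n) / 2)) * emeasure lborel A"
proof -
  let ?w = "\<lambda>x :: real ^ 'n. ennreal (pi powr (- real CARD('n) / 2) * exp (- (norm x)\<^sup>2))"
  have eq: "emeasure gauss A = (\<integral>\<^sup>+ x. ?w x * indicator A x \<partial>lborel)"
    unfolding gauss_def using assms(1) by (subst emeasure_density) auto
  have const: "(\<integral>\<^sup>+ x. C * indicator A x \<partial>lborel) = C * emeasure lborel A" for C
    using assms(1) by (simp add: nn_integral_cmult_indicator)
  show "ennreal (pi powr (- real CARD('n) / 2) * exp (- \<rho>)) * emeasure lborel A \<le> emeasure gauss A"
    unfolding eq const[symmetric] using assms(2)
    by (intro nn_integral_mono) (auto split: split_indicator intro!: ennreal_leI mult_left_mono)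
  show "emeasure gauss A \<le> ennreal (pi powr (- real CARD('n) / 2)) * emeasure lborel A"
    unfolding eq const[symmetric]
    by (intro nn_integral_mono)
       (auto split: split_indicator intro!: ennreal_leI simp: mult_le_cancel_left1)
qed

section \<open>Geometry of balls with radius inverse to the norm of the centre\<close>

text \<open>The radius is chosen so that the cross term 2 |c| |c|^-1 is exactly 2; the squared
  radius adds at most 1.\<close>

lemma norm_square_le_on_ball_inverse:
  fixes c x :: "'a::real_inner"
  assumes "1 \<le> norm c" and "x \<in> ball c (inverse (norm c))"
  shows "(norm x)\<^sup>2 \<le> (norm c)\<^sup>2 + 3"
proof -
  have "c \<noteq> 0" using assms(1) by auto
  have "norm x \<le> norm c + norm (x - c)"
    by (metis add.commute diff_add_cancel norm_triangle_ineq)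
  moreover have "norm (x - c) < inverse (norm c)"
    using assms(2) by (simp add: dist_norm norm_minus_commute)
  ultimately have "(norm x)\<^sup>2 \<le> (norm c + inverse (norm c))\<^sup>2"
    by (intro power_mono) auto
  also have "\<dots> = (norm c)\<^sup>2 + 2 + (inverse (norm c))\<^sup>2"
    using \<open>c \<noteq> 0\<close> by (simp add: power2_eq_square field_simps)
  also have "(inverse (norm c))\<^sup>2 \<le> 1"
    using assms(1) by (intro power_le_one) (auto simp: inverse_le_1_iff)
  finally show ?thesis by simp
qed

text \<open>Writing x = c + u and y = c + v, each of the three terms besides |c|^2 is at most 1 in
  absolute value by Cauchy-Schwarz.\<close>

lemma inner_ge_on_ball_inverse:
  fixes c x y :: "'a::real_inner"
  assumes "1 \<le> norm c" and "x \<in> ball c (inverse (norm c))" and "y \<in> ball c (inverse (norm c))"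
  shows "(norm c)\<^sup>2 - 3 \<le> x \<bullet> y"
proof -
  define u v where "u = x - c" and "v = y - c"
  have u: "norm u \<le> inverse (norm c)" and v: "norm v \<le> inverse (norm c)"
    using assms(2,3) by (simp_all add: u_def v_def dist_norm norm_minus_commute)
  have "norm c \<noteq> 0" using assms(1) by linarith
  then have inv: "norm c * inverse (norm c) = 1" "inverse (norm c) \<le> 1"
    using assms(1) by (simp_all add: inverse_le_1_iff)
  have "\<bar>c \<bullet> u\<bar> \<le> 1" "\<bar>c \<bullet> v\<bar> \<le> 1"
    using Cauchy_Schwarz_ineq2[of c u] Cauchy_Schwarz_ineq2[of c v]
      mult_left_mono[OF u, of "norm c"] mult_left_mono[OF v, of "norm c"] inv(1) by simp_all
  moreover have "\<bar>u \<bullet> v\<bar> \<le> 1"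
    using Cauchy_Schwarz_ineq2[of u v] mult_mono[of "norm u" 1 "norm v" 1] u v inv(2) by simp
  moreover have "x \<bullet> y = (norm c)\<^sup>2 + c \<bullet> u + c \<bullet> v + u \<bullet> v"
    by (simp add: u_def v_def power2_norm_eq_inner algebra_simps inner_commute)
  ultimately show ?thesis by linarith
qed

section \<open>Norms of indicators and lower bounds for norms\<close>

lemma ennreal_powr_mono:
  assumes "x \<le> y" and "0 \<le> a"
  shows "ennreal_powr x a \<le> ennreal_powr y a"
  using assms
  by (auto simp: ennreal_powr_def top_unique intro!: ennreal_leI powr_mono2 enn2real_mono
           simp: less_top)

lemma ennreal_powr_ennreal: "0 \<le> x \<Longrightarrow> ennreal_powr (ennreal x) a = ennreal (x powr a)"
  by (simp add: ennreal_powr_def)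

text \<open>A Chebyshev-type bound: on \<open>A\<close> the integrand is at least
  \<open>m powr q\<close>, and the outer root turns the factor back into \<open>m\<close>.\<close>

lemma Lp_norm_on_ge:
  assumes "A \<in> sets M" and "A \<subseteq> F" and "emeasure M A < \<infinity>"
    and "0 \<le> m" and "\<And>x. x \<in> A \<Longrightarrow> m \<le> g x" and "0 < q"
  shows "ennreal (m * measure M A powr (1 / q)) \<le> Lp_norm_on M q F g"
proof -
  have "ennreal (m powr q * measure M A) = (\<integral>\<^sup>+ x. ennreal (m powr q) * indicator A x \<partial>M)"
    using assms by (simp add: nn_integral_cmult_indicator ennreal_mult emeasure_eq_ennreal_measure)
  also have "\<dots> \<le> (\<integral>\<^sup>+ x. ennreal (\<bar>g x\<bar> powr q) * indicator F x \<partial>M)"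
    using assms
    by (intro nn_integral_mono)
       (force split: split_indicator intro!: ennreal_leI powr_mono2)
  finally have "ennreal_powr (ennreal (m powr q * measure M A)) (1 / q) \<le> Lp_norm_on M q F g"
    unfolding Lp_norm_on_def using assms(6) by (intro ennreal_powr_mono) auto
  moreover have "(m powr q * measure M A) powr (1 / q) = m * measure M A powr (1 / q)"
    using assms by (simp add: powr_mult powr_powr)
  ultimately show ?thesis
    by (simp add: ennreal_powr_ennreal)
qed

lemma indicator_in_Lp_space:
  assumes "A \<in> sets M" and "emeasure M A < \<infinity>"
  shows "indicator A \<in> Lp_space M p"
proof -
  have "(\<lambda>x. \<bar>indicator A x :: real\<bar> powr p) = indicator A"
    by (auto split: split_indicator)
  then show ?thesis using assms by (simp add: Lp_space_def)
qed

lemma Lp_norm_on_indicator: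
  assumes "A \<in> sets M" and "emeasure M A < \<infinity>"
  shows "Lp_norm_on M p A (indicator A) = ennreal (measure M A powr (1 / p))"
proof -
  have "(\<lambda>x. ennreal (\<bar>indicator A x\<bar> powr p) * indicator A x) = indicator A"
    by (auto split: split_indicator)
  then show ?thesis
    using assms by (simp add: Lp_norm_on_def emeasure_eq_ennreal_measure ennreal_powr_ennreal)
qed

section \<open>Gaussian measure of the test balls\<close>

lemma emeasure_gauss_bounded_lt_top:
  fixes A :: "(real ^ 'n) set"
  assumes "A \<in> sets borel" and "bounded A"
  shows "emeasure gauss A < \<infinity>"
proof -
  obtain b where "\<And>x. x \<in> A \<Longrightarrow> norm x \<le> b"
    using assms(2) by (auto simp: bounded_iff)
  then have "emeasure gauss A \<le> ennreal (pi powr (- real CARD('n) / 2)) * emeasure lborel A"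
    using assms(1) by (intro emeasure_gauss_bounds(2)[where \<rho> = "b\<^sup>2"] power_mono) auto
  also have "\<dots> < \<infinity>"
    using emeasure_bounded_finite[OF assms(2)] by (simp add: ennreal_mult_less_top)
  finally show ?thesis .
qed

text \<open>Lebesgue volume of the ball times the least density on it, where |x|^2 <= |c|^2 + 3
  costs the factor \<open>exp (- 3)\<close>.\<close>

lemma measure_gauss_ball_inverse_ge:
  fixes c :: "real ^ 'n"
  assumes "1 \<le> norm c"
  shows "pi powr (- real CARD('n) / 2) * exp (- 3) * unit_ball_vol (real CARD('n))
           * (norm c powr (- real CARD('n)) * exp (- (norm c)\<^sup>2))
         \<le> measure gauss (ball c (inverse (norm c)))"
proof -
  let ?B = "ball c (inverse (norm c))"
  have "emeasure lborel ?B = ennreal (unit_ball_vol (real CARD('n)) * inverse (norm c) ^ CARD('n))"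
    by (subst emeasure_ball) simp_all
  moreover have "inverse (norm c) ^ CARD('n) = norm c powr (- real CARD('n))"
    using assms powr_realpow[of "norm c" "CARD('n)"] by (cases "c = 0") (simp_all add: powr_minus power_inverse)
  ultimately have "ennreal (pi powr (- real CARD('n) / 2) * exp (- ((norm c)\<^sup>2 + 3)) *
        (unit_ball_vol (real CARD('n)) * norm c powr (- real CARD('n)))) \<le> emeasure gauss ?B"
    using emeasure_gauss_bounds(1)[of ?B "(norm c)\<^sup>2 + 3"] norm_square_le_on_ball_inverse[OF assms]
    by (simp add: ennreal_mult'[symmetric])
  then have "pi powr (- real CARD('n) / 2) * exp (- ((norm c)\<^sup>2 + 3)) *
        (unit_ball_vol (real CARD('n)) * norm c powr (- real CARD('n))) \<le> measure gauss ?B"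
    using emeasure_gauss_bounded_lt_top[of ?B]
    by (simp add: emeasure_eq_ennreal_measure bounded_ball)
  moreover have "exp (- ((norm c)\<^sup>2 + 3)) = exp (- 3) * exp (- (norm c)\<^sup>2)"
    by (simp flip: exp_add)
  ultimately show ?thesis by (simp add: mult_ac)
qed

section \<open>Lower bounds for the Mehler kernel and the semigroup\<close>

text \<open>Two points of the ball are at distance at most 2, so the first exponential stays above a
  constant independent of \<open>c\<close>; the second one carries the growth in |c|^2.\<close>

lemma mehler_kernel_ge_on_ball_inverse:
  fixes c x y :: "real ^ 'n"
  assumes "0 < t" and "1 \<le> norm c"
    and "x \<in> ball c (inverse (norm c))" and "y \<in> ball c (inverse (norm c))"
  shows "1 / (1 - exp (- 2 * t)) powr (real CARD('n) / 2)
           * exp (- exp (- 2 * t) * (4 / (1 - exp (- 2 * t))))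
           * exp (2 / (exp t + 1) * ((norm c)\<^sup>2 - 3)) \<le> mehler_kernel t x y"
proof -
  have "norm (x - y) \<le> 2 * inverse (norm c)"
    using assms(3,4) dist_triangle2[of x y c] by (simp add: dist_commute flip: dist_norm)
  also have "\<dots> \<le> 2" using assms(2) by (simp add: inverse_le_1_iff)
  finally have "(norm (x - y))\<^sup>2 \<le> 2\<^sup>2" by (intro power_mono) auto
  then have d: "- exp (- 2 * t) * (4 / (1 - exp (- 2 * t)))
      \<le> - exp (- 2 * t) * ((norm (x - y))\<^sup>2 / (1 - exp (- 2 * t)))"
    using assms(1) by (intro mult_left_mono_neg divide_right_mono) auto
  \<comment> \<open>Expanding by \<open>exp (- t)\<close> identifies the coefficient in the kernel
    with the quantity in the threshold condition.\<close>
  have a: "2 / (exp t + 1) = 2 * exp (- t) / (1 + exp (- t))"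
    by (simp add: exp_minus field_simps)
  have "2 / (exp t + 1) * ((norm c)\<^sup>2 - 3) \<le> 2 / (exp t + 1) * (x \<bullet> y)"
    using inner_ge_on_ball_inverse[OF assms(2-4)]
    by (intro mult_left_mono) (auto intro: add_nonneg_nonneg)
  then have e: "2 / (exp t + 1) * ((norm c)\<^sup>2 - 3) \<le> 2 * exp (- t) * ((x \<bullet> y) / (1 + exp (- t)))"
    by (simp add: a)
  show ?thesis
    unfolding mehler_kernel_def
    by (intro mult_mono iffD2[OF exp_le_cancel_iff] d e order_refl mult_nonneg_nonneg) auto
qed

lemma continuous_on_mehler_kernel: "continuous_on S (mehler_kernel t x)"
  unfolding mehler_kernel_def divide_inverse by (intro continuous_intros)

lemma ou_semigroup_indicator_ge:
  fixes A :: "(real ^ 'n) set"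
  assumes "A \<in> sets borel" and "bounded A" and "\<And>y. y \<in> A \<Longrightarrow> m \<le> mehler_kernel t x y"
  shows "m * measure gauss A \<le> ou_semigroup t (indicator A) x"
proof -
  have fin: "emeasure gauss A < \<infinity>"
    by (rule emeasure_gauss_bounded_lt_top[OF assms(1,2)])
  have meas [measurable]: "mehler_kernel t x \<in> borel_measurable borel"
    by (rule borel_measurable_continuous_onI[OF continuous_on_mehler_kernel])
  \<comment> \<open>The kernel is bounded on the compact closure of \<open>A\<close>, which gives
    integrability; without it the Bochner integral would default to 0 and monotonicity would not
    apply.\<close>
  have "compact (mehler_kernel t x ` closure A)"
    using assms(2) by (intro compact_continuous_image continuous_on_mehler_kernel) auto
  then obtain b where b: "\<And>y. y \<in> closure A \<Longrightarrow> norm (mehler_kernel t x y) \<le> b"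
    using bounded_iff[THEN iffD1, OF compact_imp_bounded] by (metis imageI)
  have "integrable gauss (\<lambda>y. mehler_kernel t x y * indicator A y)"
  proof (rule integrableI_bounded_set[of A _ _ b])
    show "A \<in> sets gauss" using assms(1) by simp
    show "(\<lambda>y. mehler_kernel t x y * indicator A y) \<in> borel_measurable gauss"
      using assms(1) by measurable
    show "AE y in gauss. y \<in> A \<longrightarrow> norm (mehler_kernel t x y * indicator A y) \<le> b"
      using b closure_subset by (intro AE_I2) auto
  qed (use fin in auto)
  moreover have "integrable gauss (\<lambda>y. m * indicator A y)"
    using assms(1) fin by simp
  ultimately have "(LINT y|gauss. m * indicator A y) \<le> ou_semigroup t (indicator A) x"
    unfolding ou_semigroup_def using assms(3)
    by (intro integral_mono) (auto split: split_indicator)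
  then show ?thesis using assms(1) fin by simp
qed

section \<open>The two forms of the threshold\<close>

text \<open>Clearing denominators turns both conditions into e^t (1 - d) < 1 + d; as 1 - d > 0, one
  may divide and take logarithms.\<close>

lemma threshold_iff_less_ln:
  fixes d t :: real
  assumes "0 \<le> d" and "d < 1"
  shows "2 / (exp t + 1) > 1 - d \<longleftrightarrow> t < ln ((1 + d) / (1 - d))"
proof -
  have "2 / (exp t + 1) > 1 - d \<longleftrightarrow> (1 - d) * (exp t + 1) < 2"
    by (intro pos_less_divide_eq add_pos_pos) auto
  also have "\<dots> \<longleftrightarrow> exp t * (1 - d) < 1 + d"
    by (auto simp: algebra_simps)
  also have "\<dots> \<longleftrightarrow> exp t < (1 + d) / (1 - d)"
    using assms by (intro pos_less_divide_eq[symmetric]) auto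
  also have "\<dots> \<longleftrightarrow> t < ln ((1 + d) / (1 - d))"
    using assms by (subst exp_less_cancel_iff[symmetric], subst exp_ln) auto
  finally show ?thesis .
qed

section \<open>Failure of the estimates as the centre tends to infinity\<close>

lemma not_off_diagonal_estimates:
  fixes p q t :: real
  assumes "1 \<le> p" and "p < q" and "t > 0" and "2 / (exp t + 1) > 1 - (1 / p - 1 / q)"
  shows "\<not> off_diagonal_estimates p q t
           {(ball c (inverse (norm c)), annulus c (inverse (norm c)) k) |
              (c :: real ^ 'n) k. 2 ^ k \<le> norm c}"
proof
  define T where "T = {(ball c (inverse (norm c)), annulus c (inverse (norm c)) k) |
      (c :: real ^ 'n) k. 2 ^ k \<le> norm c}"
  assume "off_diagonal_estimates p q t {(ball c (inverse (norm c)), annulus c (inverse (norm c)) k) |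
      (c :: real ^ 'n) k. 2 ^ k \<le> norm c}"
  then have "off_diagonal_estimates p q t T" by (simp only: T_def)
  then obtain h \<theta> K where "h > 0" "K > 0" and
    est: "\<forall>(E, F) \<in> T. \<forall>f \<in> Lp_space gauss p.
        Lp_norm_on gauss q F (ou_semigroup t (\<lambda>y. indicator E y * f y))
        \<le> ennreal (K * t powr (- \<theta>) * exp (- h * ((setdist E F)\<^sup>2 / t)))
           * Lp_norm_on gauss p E f"
    unfolding off_diagonal_estimates_def by (elim exE conjE) (rule that)
  define a s N where "a = 2 / (exp t + 1)" and "s = 1 - (1 / p - 1 / q)" and "N = real CARD('n)"
  \<comment> \<open>\<open>C1\<close> collects the factors of the kernel bound that do not depend on
    the centre, with \<open>exp (- 3 * a)\<close> coming from <x, y> >= |c|^2 - 3; \<open>C2\<close>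
    does the same for the measure of the ball.\<close>
  define C1 where "C1 = 1 / (1 - exp (- 2 * t)) powr (N / 2)
    * exp (- exp (- 2 * t) * (4 / (1 - exp (- 2 * t)))) * exp (- 3 * a)"
  define C2 where "C2 = pi powr (- N / 2) * exp (- 3) * unit_ball_vol N"
  \<comment> \<open>Since s = (1 - 1/p) + 1/q is positive, a lower bound on the measure
    \<open>g\<close> of the ball passes to \<open>g powr s\<close>.\<close>
  have "1 / p \<le> 1" "1 / q > 0" "1 / q < 1 / p"
    using assms(1,2) by (auto intro: divide_strict_left_mono)
  then have "s > 0" unfolding s_def by linarith
  have "C1 > 0" using assms(3) by (simp add: C1_def)
  have "C2 > 0" by (simp add: C2_def N_def)
  \<comment> \<open>The right-hand side is free of \<open>R\<close>, while the left-hand side will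
    be seen to diverge.\<close>
  have bound: "C1 * C2 powr s * (R powr (- N * s) * exp ((a - s) * R\<^sup>2)) \<le> K * t powr (- \<theta>)"
    if "1 \<le> R" for R
  proof -
    obtain c :: "real ^ 'n" where c: "norm c = R"
      using vector_choose_size[of R] \<open>1 \<le> R\<close> by auto
    \<comment> \<open>The choice k = 0 is admissible because 2^0 = 1 <= R.\<close>
    have in_T: "(ball c (inverse R), annulus c (inverse R) 0) \<in> T"
      unfolding T_def using c \<open>1 \<le> R\<close> by (intro CollectI exI[of _ c] exI[of _ 0]) simp
    define B g where "B = ball c (inverse R)" and "g = measure gauss B"
    have fin: "emeasure gauss B < \<infinity>"
      unfolding B_def by (intro emeasure_gauss_bounded_lt_top) auto
    have g_ge: "C2 * (R powr (- N) * exp (- R\<^sup>2)) \<le> g"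
      using measure_gauss_ball_inverse_ge[of c] \<open>1 \<le> R\<close> c
      by (simp add: B_def g_def C2_def N_def)
    moreover have "0 < C2 * (R powr (- N) * exp (- R\<^sup>2))"
      using \<open>1 \<le> R\<close> \<open>C2 > 0\<close> by simp
    ultimately have "g > 0" by linarith
    have exp_split: "exp (- 3 * a) * exp (a * R\<^sup>2) = exp (a * (R\<^sup>2 - 3))"
      by (simp add: algebra_simps flip: exp_add)
    have "C1 * exp (a * R\<^sup>2) * g \<le> ou_semigroup t (indicator B) x" if "x \<in> B" for x
      unfolding g_def
    proof (rule ou_semigroup_indicator_ge)
      fix y assume "y \<in> B"
      then show "C1 * exp (a * R\<^sup>2) \<le> mehler_kernel t x y"
        using mehler_kernel_ge_on_ball_inverse[of t c x y] that c \<open>1 \<le> R\<close> assms(3) exp_split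
        by (simp add: B_def C1_def a_def N_def mult.assoc)
    qed (auto simp: B_def)
    moreover have "B \<subseteq> annulus c (inverse R) 0"
      using \<open>1 \<le> R\<close> by (simp add: B_def annulus_def subset_ball)
    ultimately have "ennreal (C1 * exp (a * R\<^sup>2) * g * g powr (1 / q))
        \<le> Lp_norm_on gauss q (annulus c (inverse R) 0) (ou_semigroup t (indicator B))"
      unfolding g_def using fin \<open>C1 > 0\<close> \<open>1 \<le> R\<close> assms(1,2)
      by (intro Lp_norm_on_ge) (simp_all add: B_def)
    \<comment> \<open>With f = 1_B the product 1_B f in the estimate is again 1_B.\<close>
    also have "\<dots> \<le> ennreal (K * t powr (- \<theta>) * exp (- h * ((setdist B
          (annulus c (inverse R) 0))\<^sup>2 / t))) * Lp_norm_on gauss p B (indicator B)"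
      using est[rule_format, OF in_T, simplified, rule_format, of "indicator B"]
        indicator_in_Lp_space[of B gauss p] fin
      by (simp add: B_def flip: indicator_inter_arith)
    \<comment> \<open>The off-diagonal factor is at most 1, as \<open>h\<close> and \<open>t\<close>
      are positive.\<close>
    also have "\<dots> \<le> ennreal (K * t powr (- \<theta>)) * ennreal (g powr (1 / p))"
      unfolding g_def using fin \<open>K > 0\<close> \<open>h > 0\<close> assms(3)
      by (subst Lp_norm_on_indicator)
         (auto simp: B_def mult_le_cancel_left1 intro!: mult_right_mono ennreal_leI)
    also have "\<dots> = ennreal (K * t powr (- \<theta>) * g powr (1 / p))"
      using \<open>K > 0\<close> by (simp add: ennreal_mult)
    finally have "C1 * exp (a * R\<^sup>2) * g * g powr (1 / q) \<le> K * t powr (- \<theta>) * g powr (1 / p)"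
      using \<open>K > 0\<close> by (simp add: ennreal_le_iff)
    \<comment> \<open>The exponents match because 1 + 1/q = s + 1/p; the common power of
      \<open>g\<close> is then cancelled.\<close>
    moreover have "g * g powr (1 / q) = g powr s * g powr (1 / p)"
      using \<open>g > 0\<close> by (simp add: s_def powr_mult_base flip: powr_add)
    ultimately have "(C1 * exp (a * R\<^sup>2) * g powr s) * g powr (1 / p)
        \<le> (K * t powr (- \<theta>)) * g powr (1 / p)"
      by (simp add: mult.assoc)
    then have *: "C1 * exp (a * R\<^sup>2) * g powr s \<le> K * t powr (- \<theta>)"
      using \<open>g > 0\<close> by (simp only: mult_le_cancel_right) auto
    have "C2 powr s * (R powr (- N * s) * exp (- s * R\<^sup>2)) = (C2 * (R powr (- N) * exp (- R\<^sup>2))) powr s"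
      using \<open>1 \<le> R\<close> \<open>C2 > 0\<close> by (simp add: powr_mult powr_powr exp_powr_real mult.commute)
    also have "\<dots> \<le> g powr s"
      using g_ge \<open>s > 0\<close> \<open>C2 > 0\<close> \<open>1 \<le> R\<close> by (intro powr_mono2) auto
    finally have "C1 * exp (a * R\<^sup>2) * (C2 powr s * (R powr (- N * s) * exp (- s * R\<^sup>2)))
        \<le> C1 * exp (a * R\<^sup>2) * g powr s"
      using \<open>C1 > 0\<close> by (intro mult_left_mono) auto
    moreover have "exp ((a - s) * R\<^sup>2) = exp (a * R\<^sup>2) * exp (- s * R\<^sup>2)"
      by (simp add: algebra_simps flip: exp_add)
    ultimately show ?thesis using * by (simp add: mult_ac)
  qed
  define D where "D = C1 * C2 powr s"
  have "D > 0" using \<open>C1 > 0\<close> \<open>C2 > 0\<close> by (simp add: D_def)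
  have "a - s > 0" using assms(4) by (simp add: a_def s_def)
  \<comment> \<open>As a > s, the factor \<open>exp ((a - s) * R\<^sup>2)\<close> outgrows the
    polynomial decay \<open>R powr (- N * s)\<close>.\<close>
  then have "filterlim (\<lambda>R. D * (R powr (- N * s) * exp ((a - s) * R\<^sup>2))) at_top at_top"
    using \<open>D > 0\<close> by real_asymp
  then have "\<forall>\<^sub>F R in at_top. K * t powr (- \<theta>) < D * (R powr (- N * s) * exp ((a - s) * R\<^sup>2))"
    by (simp add: filterlim_at_top_dense)
  then have "\<forall>\<^sub>F R :: real in at_top. False"
    using eventually_ge_at_top[of 1]
    by eventually_elim (use bound in \<open>force simp: D_def\<close>)
  then show False by simp
qed

theorem theorem3p1:
  fixes p q t :: real
  assumes "1 \<le> p" and "p < q" and "t > 0"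
  shows "(2 / (exp t + 1) > 1 - (1 / p - 1 / q) \<longleftrightarrow>
            t < ln ((1 + (1 / p - 1 / q)) / (1 - (1 / p - 1 / q)))) \<and>
         (2 / (exp t + 1) > 1 - (1 / p - 1 / q) \<longrightarrow>
            \<not> off_diagonal_estimates p q t
                {(ball c (inverse (norm c)), annulus c (inverse (norm c)) k) |
                   (c :: real ^ 'n) k. 2 ^ k \<le> norm c})"
proof -
  have "1 / p \<le> 1" "1 / q > 0" "1 / q < 1 / p"
    using assms(1,2) by (auto intro: divide_strict_left_mono)
  \<comment> \<open>This is the range of d = 1/p - 1/q in which the two threshold conditions are
    equivalent.\<close>
  then have "0 \<le> 1 / p - 1 / q" "1 / p - 1 / q < 1"
    by linarith+
  then show ?thesis
    using threshold_iff_less_ln not_off_diagonal_estimates[OF assms] by blast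
qed

end
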